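(* Let $\mu>0$ and let $F:\mathbb R^n\to\mathbb R$ be a $C^2$ function that is $\mu$-strongly convex. Then Nesterov's accelerated gradient method with step size $s>0$, $$x_{k+1}=x_k+\beta_{\rm nag\text{-}sc}(x_k-x_{k-1})-s\nabla F\big(x_k+\beta_{\rm nag\text{-}sc}(x_k-x_{k-1})\big),$$ with Nesterov's choice $$\beta_{\rm nag\text{-}sc}=\frac{1-\sqrt{\mu s}}{1+\sqrt{\mu s}},$$ is equivalent to the template $$\begin{bmatrix} x_{k+1} \\ v_{k+1} \end{bmatrix}=\begin{bmatrix}x_k+\sqrt{s}\,\beta_{\rm nag\text{-}sc}^2v_k-s(1+\beta_{\rm nag\text{-}sc})\nabla F(x_k)\\ \beta_{\rm nag\text{-}sc} v_k-\sqrt{s}\,\nabla F(x_k)\end{bmatrix},$$ and the $O(\sqrt{s})$-resolution ODE is given by $$\begin{bmatrix} x \\ v \end{bmatrix}'=\begin{bmatrix}v\\ -2\sqrt{\mu}\,v-\nabla F(x)\end{bmatrix}+\frac{\sqrt{s}}{2}\begin{bmatrix}-6\sqrt{\mu}\,v-3\nabla F(x)\\ \nabla^2F(x)v-2\sqrt{\mu}\,\nabla F(x)\end{bmatrix}.$$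
   Context: $\mu$-strongly convex means $F(y)\ge F(x)+\langle\nabla F(x),y-x\rangle+\frac{\mu}{2}\|x-y\|^2$ for all $x,y\in\mathbb R^n$. In the template, $v_k\in\mathbb R^n$ is an auxiliary variable, and the template has the form $X_{k+1}=\Phi(X_k,\sqrt{s})$ with $X_k=(x_k,v_k)\in\mathbb R^n\times\mathbb R^n$, where $\beta_{\rm nag\text{-}sc}$ is regarded as a function of $\sqrt{s}$. Definition: for a discrete-time algorithm with an equivalent template $X^+=\Phi(X,\sqrt{s})$ satisfying $\Phi(X,0)=X$ for all $X$, an ODE $X'(t)=\Gamma_0(X(t))+\sqrt{s}\,\Gamma_1(X(t))$, $X(0)=X$, is called the $O(\sqrt{s})$-resolution ODE of the algorithm with respect to the template if $\|X(\sqrt{s})-X^+\|=o\big((\sqrt{s})^{2}\big)$. Here $\Gamma_0,\Gamma_1$ do not depend on $s$. *)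

theory Defs
  imports "HOL-Analysis.Analysis" "HOL-Library.Landau_Symbols"
begin

text \<open>
  Gradient and Hessian are total functions; they are meaningful where \<open>F\<close> is once
  resp. twice Frechet differentiable.
\<close>

definition grad :: "('a::euclidean_space \<Rightarrow> real) \<Rightarrow> 'a \<Rightarrow> 'a" where
  "grad F x = (THE g. GDERIV F x :> g)"

definition hessian :: "(real^'n::finite \<Rightarrow> real) \<Rightarrow> real^'n \<Rightarrow> real^'n^'n" where
  "hessian F x = jacobian (grad F) (at x)"

definition C2 :: "(real^'n::finite \<Rightarrow> real) \<Rightarrow> bool" where
  "C2 F \<longleftrightarrow> (\<forall>x. F differentiable (at x)) \<and> (\<forall>x. grad F differentiable (at x)) \<and>
     continuous_on UNIV (hessian F)"

definition strongly_convex :: "real \<Rightarrow> ('a::euclidean_space \<Rightarrow> real) \<Rightarrow> bool" where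
  "strongly_convex \<mu> F \<longleftrightarrow>
     (\<forall>x y. F y \<ge> F x + grad F x \<bullet> (y - x) + \<mu> / 2 * (norm (x - y))\<^sup>2)"

definition beta_nag_sc :: "real \<Rightarrow> real \<Rightarrow> real" where
  "beta_nag_sc \<mu> s = (1 - sqrt (\<mu> * s)) / (1 + sqrt (\<mu> * s))"

text \<open>
  Iterate sequences of the method with step size \<open>s\<close>; the two starting points \<open>x 0\<close>
  and \<open>x 1\<close> are arbitrary.
\<close>

definition nag_sc_sequences ::
    "('a::euclidean_space \<Rightarrow> real) \<Rightarrow> real \<Rightarrow> real \<Rightarrow> (nat \<Rightarrow> 'a) set" where
  "nag_sc_sequences F \<mu> s = {x. \<forall>k\<ge>1.
     x (k + 1) = x k + beta_nag_sc \<mu> s *\<^sub>R (x k - x (k - 1))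
       - s *\<^sub>R grad F (x k + beta_nag_sc \<mu> s *\<^sub>R (x k - x (k - 1)))}"

text \<open>
  One step of the template, as a function of the state and of \<open>h = sqrt s\<close> (so the step
  size is \<open>h\<^sup>2\<close>); only \<open>h \<ge> 0\<close> is relevant.
\<close>

definition nag_sc_template ::
    "('a::euclidean_space \<Rightarrow> real) \<Rightarrow> real \<Rightarrow> 'a \<times> 'a \<Rightarrow> real \<Rightarrow> 'a \<times> 'a" where
  "nag_sc_template F \<mu> X h =
     (let (x, v) = X; \<beta> = beta_nag_sc \<mu> (h\<^sup>2) in
       (x + (h * \<beta>\<^sup>2) *\<^sub>R v - (h\<^sup>2 * (1 + \<beta>)) *\<^sub>R grad F x,
        \<beta> *\<^sub>R v - h *\<^sub>R grad F x))"

text \<open>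
  The position variable of the template is not the iterate itself but the extrapolated
  point at which the gradient is evaluated. The consecutive iterates \<open>p = x\<^bsub>k-1\<^esub>\<close>,
  \<open>q = x\<^bsub>k\<^esub>\<close> yield the template state
  \<open>(x\<^bsub>k\<^esub> + \<beta> (x\<^bsub>k\<^esub> - x\<^bsub>k-1\<^esub>), (x\<^bsub>k\<^esub> - x\<^bsub>k-1\<^esub>) / sqrt s)\<close>.
\<close>

definition nag_sc_state :: "real \<Rightarrow> real \<Rightarrow> 'a::euclidean_space \<times> 'a \<Rightarrow> 'a \<times> 'a" where
  "nag_sc_state \<mu> s = (\<lambda>(p, q). (q + beta_nag_sc \<mu> s *\<^sub>R (q - p), (1 / sqrt s) *\<^sub>R (q - p)))"

text \<open>
  A two-step method, given by its set \<open>S\<close> of iterate sequences, is equivalent to the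
  one-step iteration \<open>X\<^bsub>k+1\<^esub> = \<Phi> X\<^bsub>k\<^esub>\<close> via \<open>\<Psi>\<close> if \<open>\<Psi>\<close> is an invertible change of variables
  on pairs of consecutive iterates that puts the iterate sequences of the method in
  one-to-one correspondence with the orbits of \<open>\<Phi>\<close>.
\<close>

definition equivalent_template_via ::
    "('a \<times> 'a \<Rightarrow> 'b) \<Rightarrow> (nat \<Rightarrow> 'a) set \<Rightarrow> ('b \<Rightarrow> 'b) \<Rightarrow> bool" where
  "equivalent_template_via \<Psi> S \<Phi> \<longleftrightarrow>
     bij \<Psi> \<and>
     bij_betw (\<lambda>x k. \<Psi> (x k, x (k + 1))) S {X. \<forall>k. X (k + 1) = \<Phi> (X k)}"

definition ode_solution ::
    "('b::real_normed_vector \<Rightarrow> 'b) \<Rightarrow> 'b \<Rightarrow> real \<Rightarrow> (real \<Rightarrow> 'b) \<Rightarrow> bool" where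
  "ode_solution \<Gamma> X T Y \<longleftrightarrow>
     Y 0 = X \<and> (\<forall>t\<in>{0..T}. (Y has_vector_derivative \<Gamma> (Y t)) (at t within {0..T}))"

text \<open>
  The vector field depends on \<open>s\<close>, so \<open>Y s\<close> denotes a solution for the parameter value \<open>s\<close>,
  evaluated at time \<open>sqrt s\<close>. If the vector field is merely continuous (as when it involves
  the Hessian of a \<open>C\<^sup>2\<close> function), solutions need not be unique: we require that solutions up to time \<open>sqrt s\<close> exist for all small \<open>s > 0\<close>, and that the
  estimate holds for every choice of solutions.
\<close>

definition sqrt_resolution_ode ::
    "('b::real_normed_vector \<Rightarrow> real \<Rightarrow> 'b) \<Rightarrow> ('b \<Rightarrow> 'b) \<Rightarrow> ('b \<Rightarrow> 'b) \<Rightarrow> bool" where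
  "sqrt_resolution_ode \<Phi> \<Gamma>\<^sub>0 \<Gamma>\<^sub>1 \<longleftrightarrow>
     (\<forall>X. \<Phi> X 0 = X) \<and>
     (\<forall>X. (\<forall>\<^sub>F s in at_right 0. \<exists>Y. ode_solution (\<lambda>Z. \<Gamma>\<^sub>0 Z + sqrt s *\<^sub>R \<Gamma>\<^sub>1 Z) X (sqrt s) Y) \<and>
          (\<forall>Y. (\<forall>\<^sub>F s in at_right 0. ode_solution (\<lambda>Z. \<Gamma>\<^sub>0 Z + sqrt s *\<^sub>R \<Gamma>\<^sub>1 Z) X (sqrt s) (Y s)) \<longrightarrow>
               (\<lambda>s. norm (Y s (sqrt s) - \<Phi> X (sqrt s))) \<in> o[at_right 0](\<lambda>s. (sqrt s)\<^sup>2)))"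

end

theory Submission
  imports Defs "HOL-Complex_Analysis.Great_Picard" "HOL-Real_Asymp.Real_Asymp"
begin

text \<open>
  The equivalence is a computation in the coordinates \<open>y = q + \<beta> (q - p)\<close>,
  \<open>v = (q - p) / sqrt s\<close>: in terms of these, an iteration of the method is \<open>q\<^sup>+ = y - s \<nabla>F(y)\<close>.

  Let \<open>h = sqrt s\<close>. If \<open>\<Gamma>\<^sub>0\<close> is differentiable and \<open>\<Gamma>\<^sub>1\<close> continuous at \<open>X\<close>, every solution
  satisfies \<open>X(h) = X + h \<Gamma>\<^sub>0 X + h\<^sup>2 (\<Gamma>\<^sub>1 X + D\<Gamma>\<^sub>0(X) \<Gamma>\<^sub>0 X / 2) + o(h\<^sup>2)\<close>: it stays within \<open>O(h)\<close>
  of \<open>X\<close>, and the mean value inequality bounds the remainder. The template has the same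
  expansion because \<open>\<beta> = 1 - 2 sqrt \<mu> h + 2 \<mu> h\<^sup>2 + O(h\<^sup>3)\<close>.

  The Hessian of a \<open>C\<^sup>2\<close> function is merely continuous, so the existence of solutions is an
  instance of Peano's theorem. Solutions of \<open>Y'(t) = f(Y(t - \<delta>))\<close> exist for trivial reasons, and
  by Arzela-Ascoli a subsequence converges as \<open>\<delta> \<rightarrow> 0\<close> to a solution of \<open>Y' = f(Y)\<close>.
\<close>

section \<open>Existence of solutions\<close>

text \<open>The mean value inequality on the convex set \<open>{0..T}\<close>, where the derivative
  is the map \<open>\<lambda>c. c *\<^sub>R Y' \<tau>\<close> of operator norm at most
  \<open>B\<close>. The growth estimates for solutions below all go through it.\<close>

lemma has_vector_derivative_bound:
  fixes Y :: "real \<Rightarrow> 'a::real_normed_vector"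
  assumes deriv: "\<And>\<tau>. \<tau> \<in> {0..T} \<Longrightarrow> (Y has_vector_derivative Y' \<tau>) (at \<tau> within {0..T})"
    and bound: "\<And>\<tau>. \<tau> \<in> {0..T} \<Longrightarrow> norm (Y' \<tau>) \<le> B"
    and "t \<in> {0..T}" "u \<in> {0..T}"
  shows "norm (Y t - Y u) \<le> B * \<bar>t - u\<bar>"
proof -
  have "norm (Y t - Y u) \<le> B * norm (t - u)"
  proof (rule differentiable_bound[where S="{0..T}" and f'="\<lambda>\<tau> c. c *\<^sub>R Y' \<tau>"])
    show "onorm (\<lambda>c. c *\<^sub>R Y' \<tau>) \<le> B" if "\<tau> \<in> {0..T}" for \<tau>
      using bound[OF that] by (intro onorm_le) (simp add: mult.commute[of B] mult_left_mono)
  qed (use assms in \<open>auto simp: has_vector_derivative_def\<close>)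
  then show ?thesis by simp
qed

text \<open>Cutting the delayed time off at \<open>0\<close> keeps it inside \<open>{0..T}\<close>,
  where \<open>Y\<close> is continuous; it amounts to extending \<open>Y\<close> to negative times
  by its value at \<open>0\<close>.\<close>

lemma continuous_on_delay:
  fixes f :: "'a::topological_space \<Rightarrow> 'b::topological_space"
  assumes "continuous_on UNIV f" "continuous_on {0..T} Y" "(\<delta>::real) > 0"
  shows "continuous_on {0..T} (\<lambda>\<tau>. f (Y (max 0 (\<tau> - \<delta>))))"
proof -
  have "continuous_on {0..T} (\<lambda>\<tau>. max 0 (\<tau> - \<delta>))"
    by (intro continuous_on_max continuous_intros)
  moreover have "(\<lambda>\<tau>. max 0 (\<tau> - \<delta>)) ` {0..T} \<subseteq> {0..T}"
    using \<open>\<delta> > 0\<close> by (auto simp: max_def)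
  ultimately show ?thesis
    by (intro continuous_on_compose2[OF assms(1)] continuous_on_compose2[OF assms(2)]) auto
qed

text \<open>
  Iterating the delayed integral operator from a constant function stabilises on the
  interval \<open>[0, k \<delta>]\<close> after \<open>k\<close> steps, so no contraction property is needed.
\<close>

lemma delayed_solution:
  fixes f :: "'a::euclidean_space \<Rightarrow> 'a"
  assumes f: "continuous_on UNIV f" and "(\<delta>::real) > 0"
  obtains Y where "continuous_on {0..T} Y"
    "\<And>t. t \<in> {0..T} \<Longrightarrow> Y t = X + integral {0..t} (\<lambda>\<tau>. f (Y (max 0 (\<tau> - \<delta>))))"
proof -
  define A where "A Y = (\<lambda>t. X + integral {0..t} (\<lambda>\<tau>. f (Y (max 0 (\<tau> - \<delta>)))))" for Y
  define I where "I k = (A ^^ k) (\<lambda>_. X)" for k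
  have I_Suc: "I (Suc k) t = X + integral {0..t} (\<lambda>\<tau>. f (I k (max 0 (\<tau> - \<delta>))))" for k t
    by (simp add: I_def A_def)
  have cont: "continuous_on {0..T} (I k)" for k
  proof (induction k)
    case (Suc k)
    have "continuous_on {0..T} (\<lambda>\<tau>. f (I k (max 0 (\<tau> - \<delta>))))"
      by (rule continuous_on_delay[OF f Suc \<open>\<delta> > 0\<close>])
    then have "continuous_on {0..T} (\<lambda>t. X + integral {0..t} (\<lambda>\<tau>. f (I k (max 0 (\<tau> - \<delta>)))))"
      by (intro continuous_intros indefinite_integral_continuous_1 integrable_continuous_real)
    then show ?case
      by (simp add: I_Suc[abs_def])
  qed (simp add: I_def)
  have agree: "I (Suc k) t = I k t" if "0 \<le> t" "t \<le> real k * \<delta>" for k t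
    using that
  proof (induction k arbitrary: t)
    case 0
    then have "t = 0" by simp
    then show ?case by (simp add: I_def A_def)
  next
    case (Suc k)
    have "integral {0..t} (\<lambda>\<tau>. f (I (Suc k) (max 0 (\<tau> - \<delta>)))) =
        integral {0..t} (\<lambda>\<tau>. f (I k (max 0 (\<tau> - \<delta>))))"
    proof (rule Henstock_Kurzweil_Integration.integral_cong)
      fix \<tau> assume "\<tau> \<in> {0..t}"
      \<comment> \<open>The delay moves times up to \<open>(k + 1) * \<delta>\<close> back to at
        most \<open>k * \<delta>\<close>, where the induction hypothesis applies.\<close>
      then have "max 0 (\<tau> - \<delta>) \<le> real k * \<delta>"
        using Suc.prems \<open>\<delta> > 0\<close> by (auto simp: algebra_simps)
      then show "f (I (Suc k) (max 0 (\<tau> - \<delta>))) = f (I k (max 0 (\<tau> - \<delta>)))"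
        by (simp add: Suc.IH)
    qed
    then show ?case by (simp add: I_Suc)
  qed
  \<comment> \<open>After \<open>N\<close> steps all of \<open>{0..T}\<close> is covered, and there
    \<open>I N\<close> is a fixed point of \<open>A\<close>.\<close>
  obtain N where N: "T \<le> real N * \<delta>"
    using reals_Archimedean3[OF \<open>\<delta> > 0\<close>] less_imp_le by blast
  show ?thesis
  proof (rule that[OF cont[of N]])
    show "I N t = X + integral {0..t} (\<lambda>\<tau>. f (I N (max 0 (\<tau> - \<delta>))))" if "t \<in> {0..T}" for t
      using agree[of t N] N that by (simp add: I_Suc)
  qed
qed

text \<open>The global bound makes every delayed solution \<open>M\<close>-Lipschitz, so the family
  is uniformly bounded and equicontinuous. The integral equation, unlike the differential one,
  survives a uniform limit, by dominated convergence.\<close>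

lemma peano_bounded:
  fixes f :: "'a::euclidean_space \<Rightarrow> 'a"
  assumes f: "continuous_on UNIV f" and M: "\<And>x. norm (f x) \<le> M" and "0 \<le> T"
  obtains Y where "ode_solution f X T Y"
proof -
  define \<delta> where "\<delta> n = 1 / real (Suc n)" for n
  have \<delta>: "\<delta> n > 0" for n by (simp add: \<delta>_def)
  have "\<forall>n. \<exists>Y. continuous_on {0..T} Y \<and>
      (\<forall>t\<in>{0..T}. Y t = X + integral {0..t} (\<lambda>\<tau>. f (Y (max 0 (\<tau> - \<delta> n)))))"
    by (metis delayed_solution[OF f \<delta>])
  then obtain Z where Z_cont: "\<And>n. continuous_on {0..T} (Z n)"
    and Z: "\<And>n t. t \<in> {0..T} \<Longrightarrow> Z n t = X + integral {0..t} (\<lambda>\<tau>. f (Z n (max 0 (\<tau> - \<delta> n))))"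
    by metis
  define g where "g n \<tau> = f (Z n (max 0 (\<tau> - \<delta> n)))" for n \<tau>
  have g_cont: "continuous_on {0..T} (g n)" for n
    unfolding g_def by (rule continuous_on_delay[OF f Z_cont \<delta>])
  have "0 \<le> M" using M[of 0] norm_ge_zero order_trans by blast
  have Z_deriv: "(Z n has_vector_derivative g n t) (at t within {0..T})" if "t \<in> {0..T}" for n t
  proof -
    have "((\<lambda>t. X + integral {0..t} (g n)) has_vector_derivative 0 + g n t) (at t within {0..T})"
      by (intro has_vector_derivative_add has_vector_derivative_const
          integral_has_vector_derivative g_cont that)
    then have "((\<lambda>t. X + integral {0..t} (g n)) has_vector_derivative g n t) (at t within {0..T})"
      by simp
    then show ?thesis
      by (rule has_vector_derivative_transform[rotated 2]) (use that Z in \<open>auto simp: g_def[abs_def]\<close>)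
  qed
  have lip: "norm (Z n t - Z n u) \<le> M * \<bar>t - u\<bar>" if "t \<in> {0..T}" "u \<in> {0..T}" for n t u
    by (rule has_vector_derivative_bound[OF Z_deriv _ that]) (simp_all add: g_def M)
  have Z0: "Z n 0 = X" for n using Z[of 0 n] \<open>0 \<le> T\<close> by simp
  have bdd: "norm (Z n t) \<le> norm X + M * T" if "t \<in> {0..T}" for n t
  proof -
    have "norm (Z n t - X) \<le> M * t" using lip[of t 0 n] Z0 that by auto
    also have "\<dots> \<le> M * T" using that \<open>0 \<le> M\<close> by (intro mult_left_mono) auto
    finally show ?thesis using norm_triangle_sub[of "Z n t" X] by linarith
  qed
  have equi: "\<exists>d>0. \<forall>n y. y \<in> {0..T} \<and> norm (x - y) < d \<longrightarrow> norm (Z n x - Z n y) < e"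
    if "x \<in> {0..T}" "e > 0" for x e
  \<comment> \<open>Dividing by \<open>M + 1\<close> instead of \<open>M\<close> covers the case
    \<open>M = 0\<close>.\<close>
  proof (intro exI[of _ "e / (M + 1)"] conjI allI impI)
    show "e / (M + 1) > 0" using that \<open>0 \<le> M\<close> by simp
    fix n y assume y: "y \<in> {0..T} \<and> norm (x - y) < e / (M + 1)"
    have "norm (Z n x - Z n y) \<le> M * \<bar>x - y\<bar>" using lip that y by blast
    also have "\<dots> \<le> (M + 1) * \<bar>x - y\<bar>" by (simp add: algebra_simps)
    also have "\<dots> < e" using y \<open>0 \<le> M\<close> by (simp add: field_simps)
    finally show "norm (Z n x - Z n y) < e" .
  qed
  obtain Y k where Y_cont: "continuous_on {0..T} Y" and k: "strict_mono (k :: nat \<Rightarrow> nat)"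
    and lim: "\<And>e. 0 < e \<Longrightarrow> \<exists>N. \<forall>n x. n \<ge> N \<and> x \<in> {0..T} \<longrightarrow> norm (Z (k n) x - Y x) < e"
    by (rule Arzela_Ascoli[of "{0..T}" Z, OF _ bdd equi]) auto
  have Z_lim: "(\<lambda>n. Z (k n) t) \<longlonglongrightarrow> Y t" if "t \<in> {0..T}" for t
    unfolding lim_sequentially dist_norm using lim that by blast
  have "\<delta> \<longlonglongrightarrow> 0"
    unfolding \<delta>_def[abs_def] using LIMSEQ_inverse_real_of_nat by (simp add: inverse_eq_divide)
  then have \<delta>_lim: "(\<lambda>n. \<delta> (k n)) \<longlonglongrightarrow> 0"
    using LIMSEQ_subseq_LIMSEQ[OF _ k] by (auto simp: o_def)
  have g_lim: "(\<lambda>n. g (k n) t) \<longlonglongrightarrow> f (Y t)" if t: "t \<in> {0..T}" for t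
  proof -
    \<comment> \<open>The Lipschitz constant does not depend on \<open>n\<close>, so shifting the
      argument by at most \<open>\<delta> (k n)\<close> has no effect in the limit.\<close>
    have "(\<lambda>n. Z (k n) (max 0 (t - \<delta> (k n))) - Z (k n) t) \<longlonglongrightarrow> 0"
    proof (rule Lim_null_comparison)
      show "\<forall>\<^sub>F n in sequentially.
          norm (Z (k n) (max 0 (t - \<delta> (k n))) - Z (k n) t) \<le> M * \<delta> (k n)"
      proof (intro always_eventually allI)
        fix n
        have "norm (Z (k n) (max 0 (t - \<delta> (k n))) - Z (k n) t) \<le> M * \<bar>max 0 (t - \<delta> (k n)) - t\<bar>"
          using t \<delta>[of "k n"] by (intro lip) auto
        also have "\<dots> \<le> M * \<delta> (k n)"
          using t \<delta>[of "k n"] \<open>0 \<le> M\<close> by (intro mult_left_mono) auto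
        finally show "norm (Z (k n) (max 0 (t - \<delta> (k n))) - Z (k n) t) \<le> M * \<delta> (k n)" .
      qed
      show "(\<lambda>n. M * \<delta> (k n)) \<longlonglongrightarrow> 0" using tendsto_mult_left[OF \<delta>_lim, of M] by simp
    qed
    from tendsto_add[OF this Z_lim[OF t]]
    have "(\<lambda>n. Z (k n) (max 0 (t - \<delta> (k n)))) \<longlonglongrightarrow> Y t" by simp
    moreover have "isCont f (Y t)" using f by (simp add: continuous_on_eq_continuous_at)
    ultimately show ?thesis unfolding g_def by (rule isCont_tendsto_compose[rotated])
  qed
  have fY_cont: "continuous_on {0..T} (\<lambda>t. f (Y t))"
    by (rule continuous_on_compose2[OF f Y_cont]) auto
  have Y_int: "Y t = X + integral {0..t} (\<lambda>\<tau>. f (Y \<tau>))" if t: "t \<in> {0..T}" for t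
  proof -
    have "(\<lambda>n. integral {0..t} (g (k n))) \<longlonglongrightarrow> integral {0..t} (\<lambda>\<tau>. f (Y \<tau>))"
    proof (rule dominated_convergence(2)[where h="\<lambda>_. M"])
      show "g (k n) integrable_on {0..t}" for n
        by (intro integrable_continuous_real continuous_on_subset[OF g_cont]) (use t in auto)
      show "norm (g (k n) \<tau>) \<le> M" for n \<tau> by (simp add: g_def M)
    qed (use t g_lim in auto)
    then have "(\<lambda>n. X + integral {0..t} (g (k n))) \<longlonglongrightarrow> X + integral {0..t} (\<lambda>\<tau>. f (Y \<tau>))"
      by (intro tendsto_intros)
    moreover have "(\<lambda>n. X + integral {0..t} (g (k n))) \<longlonglongrightarrow> Y t"
      using Z_lim[OF t] Z[OF t] by (simp add: g_def[abs_def])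
    ultimately show ?thesis using LIMSEQ_unique by blast
  qed
  have "(Y has_vector_derivative f (Y t)) (at t within {0..T})" if "t \<in> {0..T}" for t
  proof -
    have "((\<lambda>t. X + integral {0..t} (\<lambda>\<tau>. f (Y \<tau>))) has_vector_derivative 0 + f (Y t)) (at t within {0..T})"
      by (intro has_vector_derivative_add has_vector_derivative_const
          integral_has_vector_derivative fY_cont that)
    then have "((\<lambda>t. X + integral {0..t} (\<lambda>\<tau>. f (Y \<tau>))) has_vector_derivative f (Y t)) (at t within {0..T})"
      by simp
    then show ?thesis
      by (rule has_vector_derivative_transform[rotated 2]) (use that Y_int in auto)
  qed
  moreover have "Y 0 = X" using Y_int[of 0] \<open>0 \<le> T\<close> by simp
  ultimately show ?thesis by (intro that[of Y]) (auto simp: ode_solution_def)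
qed

section \<open>Confinement to a ball and local existence\<close>

text \<open>As long as the solution is in the unit ball its speed is at most \<open>M\<close>, and
  at that speed it cannot reach the boundary before time \<open>T\<close>. A first-exit argument
  makes this rigorous.\<close>

lemma ode_solution_in_cball:
  fixes f :: "'a::euclidean_space \<Rightarrow> 'a"
  assumes Y: "ode_solution f X T Y" and M: "\<And>Z. Z \<in> cball X 1 \<Longrightarrow> norm (f Z) \<le> M"
    and "M * T < 1" and t: "t \<in> {0..T}"
  shows "norm (Y t - X) \<le> M * t"
proof -
  have Y0: "Y 0 = X" and deriv: "\<And>t. t \<in> {0..T} \<Longrightarrow> (Y has_vector_derivative f (Y t)) (at t within {0..T})"
    using Y by (auto simp: ode_solution_def)
  have "0 \<le> M" using order_trans[OF norm_ge_zero M[of X]] by simp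
  \<comment> \<open>The estimate under the extra assumption that the ball has not been left up to
    time \<open>u\<close>; the rest of the proof removes this assumption.\<close>
  have le: "norm (Y u - X) \<le> M * u" if u: "u \<in> {0..T}" and in_ball: "\<forall>\<tau>\<in>{0..u}. norm (Y \<tau> - X) \<le> 1" for u
  proof -
    have "norm (Y u - Y 0) \<le> M * \<bar>u - 0\<bar>"
    proof (rule has_vector_derivative_bound[where T=u])
      fix \<tau> assume \<tau>: "\<tau> \<in> {0..u}"
      then show "(Y has_vector_derivative f (Y \<tau>)) (at \<tau> within {0..u})"
        using u by (intro has_vector_derivative_within_subset[OF deriv]) auto
      show "norm (f (Y \<tau>)) \<le> M"
        using in_ball \<tau> by (intro M) (auto simp: dist_norm norm_minus_commute)
    qed (use u in auto)
    then show ?thesis using u Y0 by simp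
  qed
  have cont: "continuous_on {0..T} (\<lambda>t. norm (Y t - X))"
    by (intro continuous_intros)
      (simp add: continuous_on_eq_continuous_within has_vector_derivative_continuous[OF deriv])
  have "norm (Y \<tau> - X) \<le> 1" if \<tau>: "\<tau> \<in> {0..T}" for \<tau>
  proof (rule ccontr)
    assume "\<not> norm (Y \<tau> - X) \<le> 1"
    \<comment> \<open>The minimum \<open>u\<close> of \<open>S\<close> is the first time at distance
      at least \<open>1\<close>. Up to \<open>u\<close> the conditional estimate applies and gives a
      distance of at most \<open>M * u < 1\<close>, a contradiction.\<close>
    define S where "S = {0..T} \<inter> (\<lambda>t. norm (Y t - X)) -` {1..}"
    have "closed S"
      unfolding S_def by (rule continuous_closed_preimage[OF cont]) auto
    moreover have "bounded S"
      by (rule bounded_subset[of "{0..T}"]) (auto simp: S_def)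
    ultimately have "compact S" by (simp add: compact_eq_bounded_closed)
    moreover have "\<tau> \<in> S" using \<tau> \<open>\<not> norm (Y \<tau> - X) \<le> 1\<close> by (auto simp: S_def)
    ultimately obtain u where u: "u \<in> S" "\<And>v. v \<in> S \<Longrightarrow> u \<le> v"
      using compact_attains_inf[of S] by blast
    then have uT: "u \<in> {0..T}" and "1 \<le> norm (Y u - X)" by (auto simp: S_def)
    have lt: "norm (Y v - X) < 1" if "v \<in> {0..<u}" for v
    proof (rule ccontr)
      assume "\<not> norm (Y v - X) < 1"
      then have "v \<in> S" using that uT by (auto simp: S_def)
      then show False using u(2)[of v] that by simp
    qed
    \<comment> \<open>If the distance at \<open>u\<close> exceeded \<open>1\<close>, it would equal
      \<open>1\<close> at an earlier time by the intermediate value theorem.\<close>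
    have "norm (Y u - X) \<le> 1"
    proof (rule ccontr)
      assume gt: "\<not> norm (Y u - X) \<le> 1"
      have "continuous_on {0..u} (\<lambda>t. norm (Y t - X))"
        by (rule continuous_on_subset[OF cont]) (use uT in auto)
      then obtain v where "0 \<le> v" "v \<le> u" "norm (Y v - X) = 1"
        using IVT'[of "\<lambda>t. norm (Y t - X)" 0 1 u] Y0 gt uT by auto
      then show False using lt[of v] gt by (cases "v = u") auto
    qed
    then have "\<forall>v\<in>{0..u}. norm (Y v - X) \<le> 1"
      using lt by (metis atLeastAtMost_iff atLeastLessThan_iff less_eq_real_def)
    then have "norm (Y u - X) \<le> M * u" by (rule le[OF uT])
    also have "\<dots> \<le> M * T" using uT \<open>0 \<le> M\<close> by (intro mult_left_mono) auto
    finally show False using \<open>M * T < 1\<close> \<open>1 \<le> norm (Y u - X)\<close> by simp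
  qed
  then show ?thesis using le[OF t] t by auto
qed

text \<open>Composing \<open>f\<close> with the nearest-point projection \<open>p\<close> onto the
  ball makes it globally bounded and keeps it continuous. The solution of the modified equation
  never leaves the ball, where \<open>p\<close> is the identity.\<close>

lemma peano_local:
  fixes f :: "'a::euclidean_space \<Rightarrow> 'a"
  assumes f: "continuous_on UNIV f" and M: "\<And>Z. Z \<in> cball X 1 \<Longrightarrow> norm (f Z) \<le> M"
    and "M * T < 1" and "0 \<le> T"
  obtains Y where "ode_solution f X T Y"
proof -
  define p where "p = closest_point (cball X 1)"
  have p_in: "p Z \<in> cball X 1" for Z unfolding p_def by (rule closest_point_in_set) auto
  have "continuous_on UNIV (\<lambda>Z. f (p Z))"
    unfolding p_def
    by (rule continuous_on_compose2[OF f]) (auto intro!: continuous_on_closest_point)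
  then obtain Y where Y: "ode_solution (\<lambda>Z. f (p Z)) X T Y"
    using peano_bounded[of "\<lambda>Z. f (p Z)" M T X] M p_in \<open>0 \<le> T\<close> by blast
  have "p (Y t) = Y t" if t: "t \<in> {0..T}" for t
  proof -
    have "0 \<le> M" using order_trans[OF norm_ge_zero M[of X]] by simp
    have "norm (Y t - X) \<le> M * t"
      using ode_solution_in_cball[OF Y M[OF p_in] \<open>M * T < 1\<close> t] .
    also have "\<dots> \<le> M * T" using t \<open>0 \<le> M\<close> by (intro mult_left_mono) auto
    finally have "Y t \<in> cball X 1" using \<open>M * T < 1\<close> by (simp add: dist_norm norm_minus_commute)
    then show ?thesis unfolding p_def by (rule closest_point_self)
  qed
  then have "ode_solution f X T Y" using Y by (auto simp: ode_solution_def)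
  then show ?thesis by (rule that)
qed

section \<open>Second-order expansion of solutions\<close>

text \<open>The second derivative of a solution is \<open>L (G\<^sub>0 X)\<close> to leading order,
  whence the factor \<open>1 / 2\<close>; the term \<open>h *\<^sub>R G\<^sub>1 X\<close> acts for a
  time \<open>h\<close> and contributes without it. The threshold \<open>\<delta>\<close> is uniform
  over all solutions \<open>Y\<close>, so uniqueness never enters.\<close>

lemma ode_solution_second_order:
  fixes G\<^sub>0 G\<^sub>1 :: "'a::euclidean_space \<Rightarrow> 'a"
  assumes M: "\<And>Z h. Z \<in> cball X 1 \<Longrightarrow> 0 \<le> h \<Longrightarrow> h \<le> 1 \<Longrightarrow> norm (G\<^sub>0 Z + h *\<^sub>R G\<^sub>1 Z) \<le> M"
    and L: "(G\<^sub>0 has_derivative L) (at X)" and G\<^sub>1: "isCont G\<^sub>1 X" and "\<epsilon> > 0"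
  obtains \<delta> where "\<delta> > 0"
    "\<And>h Y. 0 < h \<Longrightarrow> h < \<delta> \<Longrightarrow> ode_solution (\<lambda>Z. G\<^sub>0 Z + h *\<^sub>R G\<^sub>1 Z) X h Y \<Longrightarrow>
       norm (Y h - (X + h *\<^sub>R G\<^sub>0 X + h\<^sup>2 *\<^sub>R (G\<^sub>1 X + (1 / 2) *\<^sub>R L (G\<^sub>0 X)))) \<le> \<epsilon> * h\<^sup>2"
proof -
  interpret L: bounded_linear L by (rule has_derivative_bounded_linear[OF L])
  obtain K where "K > 0" and K: "\<And>z. norm (L z) \<le> norm z * K" using L.pos_bounded by blast
  have "0 \<le> M" using order_trans[OF norm_ge_zero M[of X 0]] by simp
  define N where "N = norm (G\<^sub>1 X) + 1"
  \<comment> \<open>The final remainder is \<open>\<eta> * (M + 2) * h\<^sup>2\<close>; the cap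
    \<open>1\<close> simplifies the constants of the first-order estimate.\<close>
  define \<eta> where "\<eta> = min 1 (\<epsilon> / (M + 2))"
  have "\<eta> > 0" "\<eta> \<le> 1" using \<open>\<epsilon> > 0\<close> \<open>0 \<le> M\<close> by (auto simp: \<eta>_def)
  have "\<eta> \<le> \<epsilon> / (M + 2)" by (simp add: \<eta>_def)
  then have \<eta>_le: "\<eta> * (M + 2) \<le> \<epsilon>" using \<open>0 \<le> M\<close> by (simp add: field_simps)
  obtain d\<^sub>0 where "d\<^sub>0 > 0"
    and d\<^sub>0: "\<And>Z. norm (Z - X) < d\<^sub>0 \<Longrightarrow> norm (G\<^sub>0 Z - G\<^sub>0 X - L (Z - X)) \<le> \<eta> * norm (Z - X)"
    using L \<open>\<eta> > 0\<close> unfolding has_derivative_at_alt by blast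
  obtain d\<^sub>1 where "d\<^sub>1 > 0" and d\<^sub>1: "\<And>Z. norm (Z - X) < d\<^sub>1 \<Longrightarrow> norm (G\<^sub>1 Z - G\<^sub>1 X) < \<eta>"
    using G\<^sub>1 \<open>\<eta> > 0\<close> unfolding continuous_at_eps_delta dist_norm by blast
  \<comment> \<open>\<open>C * h\<close> bounds the derivative of \<open>D\<close> below:
    \<open>M\<close> comes from the linearization error of \<open>G\<^sub>0\<close>,
    \<open>K * M\<close> from \<open>L\<close>, and \<open>N\<close> from
    \<open>G\<^sub>1\<close>.\<close>
  define C where "C = (1 + K) * M + N"
  have "C > 0" using \<open>0 \<le> M\<close> \<open>K > 0\<close> unfolding C_def N_def
    by (smt (verit) mult_nonneg_nonneg norm_ge_zero)
  \<comment> \<open>In order: \<open>h < 1\<close> for the bound \<open>M\<close>;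
    \<open>K * C * h \<le> \<eta>\<close> to absorb the first-order error; \<open>M * h\<close>
    below \<open>1\<close>, \<open>d\<^sub>0\<close> and \<open>d\<^sub>1\<close>, so that the
    solution stays in the ball and in both neighbourhoods of \<open>X\<close>.\<close>
  define \<delta> where "\<delta> = min (min 1 (\<eta> / (K * C))) (min 1 (min d\<^sub>0 d\<^sub>1) / (M + 1))"
  have "\<delta> > 0" using \<open>\<eta> > 0\<close> \<open>K > 0\<close> \<open>C > 0\<close> \<open>d\<^sub>0 > 0\<close> \<open>d\<^sub>1 > 0\<close> \<open>0 \<le> M\<close> by (simp add: \<delta>_def)
  moreover have "norm (Y h - (X + h *\<^sub>R G\<^sub>0 X + h\<^sup>2 *\<^sub>R (G\<^sub>1 X + (1 / 2) *\<^sub>R L (G\<^sub>0 X)))) \<le> \<epsilon> * h\<^sup>2"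
    if h: "0 < h" "h < \<delta>" and Y: "ode_solution (\<lambda>Z. G\<^sub>0 Z + h *\<^sub>R G\<^sub>1 Z) X h Y" for h Y
  proof -
    have h1: "h < 1" and "h < \<eta> / (K * C)" and "h < min 1 (min d\<^sub>0 d\<^sub>1) / (M + 1)"
      using h by (auto simp: \<delta>_def)
    then have KCh: "K * C * h \<le> \<eta>" and "(M + 1) * h < min 1 (min d\<^sub>0 d\<^sub>1)"
      using \<open>K > 0\<close> \<open>C > 0\<close> \<open>0 \<le> M\<close> by (auto simp: field_simps)
    then have Mh: "M * h < min 1 (min d\<^sub>0 d\<^sub>1)" using h(1) by (simp add: algebra_simps)
    have Y0: "Y 0 = X" and deriv: "\<And>t. t \<in> {0..h} \<Longrightarrow>
        (Y has_vector_derivative G\<^sub>0 (Y t) + h *\<^sub>R G\<^sub>1 (Y t)) (at t within {0..h})"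
      using Y by (auto simp: ode_solution_def)
    have near: "norm (Y t - X) \<le> M * h" if t: "t \<in> {0..h}" for t
    proof -
      have "norm (Y t - X) \<le> M * t"
        by (rule ode_solution_in_cball[OF Y _ _ t]) (use M h h1 Mh in auto)
      also have "\<dots> \<le> M * h" using t \<open>0 \<le> M\<close> by (intro mult_left_mono) auto
      finally show ?thesis .
    qed
    have G\<^sub>0_near: "norm (G\<^sub>0 (Y t) - G\<^sub>0 X - L (Y t - X)) \<le> \<eta> * (M * h)"
      and G\<^sub>1_near: "norm (G\<^sub>1 (Y t) - G\<^sub>1 X) \<le> \<eta>" if t: "t \<in> {0..h}" for t
    proof -
      have "norm (G\<^sub>0 (Y t) - G\<^sub>0 X - L (Y t - X)) \<le> \<eta> * norm (Y t - X)"
        using near[OF t] Mh by (intro d\<^sub>0) auto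
      also have "\<dots> \<le> \<eta> * (M * h)" using near[OF t] \<open>\<eta> > 0\<close> by simp
      finally show "norm (G\<^sub>0 (Y t) - G\<^sub>0 X - L (Y t - X)) \<le> \<eta> * (M * h)" .
      show "norm (G\<^sub>1 (Y t) - G\<^sub>1 X) \<le> \<eta>"
        using near[OF t] Mh by (intro less_imp_le d\<^sub>1) auto
    qed
    \<comment> \<open>a first-order expansion of \<open>Y\<close> is bootstrapped to the second-order one for \<open>R\<close>\<close>
    define D where "D t = Y t - t *\<^sub>R G\<^sub>0 X" for t
    have D: "norm (D t - X) \<le> C * h * h" if t: "t \<in> {0..h}" for t
    proof -
      have "norm (D t - D 0) \<le> C * h * \<bar>t - 0\<bar>"
      proof (rule has_vector_derivative_bound[where T=h])
        fix \<tau> assume \<tau>: "\<tau> \<in> {0..h}"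
        show "(D has_vector_derivative G\<^sub>0 (Y \<tau>) + h *\<^sub>R G\<^sub>1 (Y \<tau>) - G\<^sub>0 X) (at \<tau> within {0..h})"
          unfolding D_def by (rule derivative_eq_intros deriv[OF \<tau>] refl)+ simp
        have "norm (G\<^sub>0 (Y \<tau>) + h *\<^sub>R G\<^sub>1 (Y \<tau>) - G\<^sub>0 X) =
            norm ((G\<^sub>0 (Y \<tau>) - G\<^sub>0 X - L (Y \<tau> - X)) + L (Y \<tau> - X) + h *\<^sub>R ((G\<^sub>1 (Y \<tau>) - G\<^sub>1 X) + G\<^sub>1 X))"
          by (simp add: algebra_simps)
        also have "\<dots> \<le> \<eta> * (M * h) + (M * h) * K + h * (\<eta> + norm (G\<^sub>1 X))"
        proof (intro norm_triangle_le add_mono G\<^sub>0_near \<tau>)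
          show "norm (L (Y \<tau> - X)) \<le> M * h * K"
            using K[of "Y \<tau> - X"] near[OF \<tau>] \<open>K > 0\<close> by (meson less_imp_le mult_right_mono order_trans)
          have "norm ((G\<^sub>1 (Y \<tau>) - G\<^sub>1 X) + G\<^sub>1 X) \<le> \<eta> + norm (G\<^sub>1 X)"
            by (intro norm_triangle_le add_mono G\<^sub>1_near \<tau> order_refl)
          then show "norm (h *\<^sub>R ((G\<^sub>1 (Y \<tau>) - G\<^sub>1 X) + G\<^sub>1 X)) \<le> h * (\<eta> + norm (G\<^sub>1 X))"
            using h(1) by simp
        qed
        also have "\<dots> \<le> 1 * (M * h) + (M * h) * K + h * (1 + norm (G\<^sub>1 X))"
          using \<open>\<eta> \<le> 1\<close> \<open>0 \<le> M\<close> h(1) by (intro add_mono mult_right_mono mult_left_mono) auto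
        also have "\<dots> = C * h" by (simp add: C_def N_def algebra_simps)
        finally show "norm (G\<^sub>0 (Y \<tau>) + h *\<^sub>R G\<^sub>1 (Y \<tau>) - G\<^sub>0 X) \<le> C * h" .
      qed (use t in auto)
      also have "\<dots> \<le> C * h * h" using t \<open>C > 0\<close> by (intro mult_left_mono) auto
      finally show ?thesis by (simp add: D_def Y0)
    qed
    \<comment> \<open>The \<open>G\<^sub>1\<close> term carries \<open>t * h\<close> because
      \<open>h\<close> is a fixed parameter of the field while \<open>t\<close> is time. Since
      \<open>R 0 = X\<close>, the difference \<open>R h - R 0\<close> is exactly the error to be
      bounded.\<close>
    define R where "R t = Y t - t *\<^sub>R G\<^sub>0 X - (t * h) *\<^sub>R G\<^sub>1 X - (t\<^sup>2 / 2) *\<^sub>R L (G\<^sub>0 X)" for t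
    have "norm (R h - R 0) \<le> \<eta> * (M + 2) * h * \<bar>h - 0\<bar>"
    proof (rule has_vector_derivative_bound[where T=h])
      fix t assume t: "t \<in> {0..h}"
      show "(R has_vector_derivative G\<^sub>0 (Y t) + h *\<^sub>R G\<^sub>1 (Y t) - G\<^sub>0 X - h *\<^sub>R G\<^sub>1 X - t *\<^sub>R L (G\<^sub>0 X))
          (at t within {0..h})"
      proof -
        have "((\<lambda>t. t\<^sup>2 / 2) has_field_derivative t) (at t within {0..h})"
          by (auto intro!: derivative_eq_intros)
        then show ?thesis
          unfolding R_def
          by (auto intro!: derivative_eq_intros deriv[OF t] has_vector_derivative_scaleR)
      qed
      \<comment> \<open>By linearity
        \<open>L (Y t - X) - t *\<^sub>R L (G\<^sub>0 X) = L (D t - X)\<close>, which the estimate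
        for \<open>D\<close> makes quadratic in \<open>h\<close>.\<close>
      have "norm (G\<^sub>0 (Y t) + h *\<^sub>R G\<^sub>1 (Y t) - G\<^sub>0 X - h *\<^sub>R G\<^sub>1 X - t *\<^sub>R L (G\<^sub>0 X)) =
          norm ((G\<^sub>0 (Y t) - G\<^sub>0 X - L (Y t - X)) + L (D t - X) + h *\<^sub>R (G\<^sub>1 (Y t) - G\<^sub>1 X))"
        by (simp add: D_def L.add L.diff L.scaleR algebra_simps)
      also have "\<dots> \<le> \<eta> * (M * h) + C * h * h * K + h * \<eta>"
      proof (intro norm_triangle_le add_mono G\<^sub>0_near t)
        show "norm (L (D t - X)) \<le> C * h * h * K"
          using K[of "D t - X"] D[OF t] \<open>K > 0\<close> by (meson less_imp_le mult_right_mono order_trans)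
        show "norm (h *\<^sub>R (G\<^sub>1 (Y t) - G\<^sub>1 X)) \<le> h * \<eta>" using h(1) G\<^sub>1_near[OF t] by simp
      qed
      also have "\<dots> = \<eta> * (M + 1) * h + (K * C * h) * h" by (simp add: algebra_simps)
      also have "\<dots> \<le> \<eta> * (M + 1) * h + \<eta> * h" using mult_right_mono[OF KCh, of h] h(1) by simp
      finally show "norm (G\<^sub>0 (Y t) + h *\<^sub>R G\<^sub>1 (Y t) - G\<^sub>0 X - h *\<^sub>R G\<^sub>1 X - t *\<^sub>R L (G\<^sub>0 X)) \<le> \<eta> * (M + 2) * h"
        by (simp add: algebra_simps)
    qed (use h in auto)
    also have "\<dots> = \<eta> * (M + 2) * h\<^sup>2" using h(1) by (simp add: power2_eq_square)
    also have "\<dots> \<le> \<epsilon> * h\<^sup>2" using \<eta>_le by (rule mult_right_mono) simp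
    finally show ?thesis by (simp add: R_def Y0 power2_eq_square algebra_simps)
  qed
  ultimately show ?thesis by (rule that)
qed

section \<open>Reduction to an expansion of the template\<close>

text \<open>Solution and template step are compared through the same second-order polynomial in
  \<open>h\<close>; the triangle inequality then gives the claim after substituting
  \<open>h = sqrt s\<close>.\<close>

lemma sqrt_resolution_odeI:
  fixes G\<^sub>0 G\<^sub>1 :: "'a::euclidean_space \<Rightarrow> 'a"
  assumes \<Phi>0: "\<And>X. \<Phi> X 0 = X" and L: "\<And>X. (G\<^sub>0 has_derivative L X) (at X)"
    and G\<^sub>1: "continuous_on UNIV G\<^sub>1"
    and expansion: "\<And>X. (\<lambda>h. norm (\<Phi> X h - (X + h *\<^sub>R G\<^sub>0 X + h\<^sup>2 *\<^sub>R (G\<^sub>1 X + (1 / 2) *\<^sub>R L X (G\<^sub>0 X)))))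
      \<in> o[at_right 0](\<lambda>h. h\<^sup>2)"
  shows "sqrt_resolution_ode \<Phi> G\<^sub>0 G\<^sub>1"
  unfolding sqrt_resolution_ode_def
proof (intro conjI allI impI)
  fix X
  let ?f = "\<lambda>s Z. G\<^sub>0 Z + sqrt s *\<^sub>R G\<^sub>1 Z"
  have G\<^sub>0: "continuous_on UNIV G\<^sub>0"
    using has_derivative_continuous[OF L] by (simp add: continuous_on_eq_continuous_at)
  have "\<exists>B. \<forall>Z\<in>cball X 1. norm (G Z) \<le> B" if "continuous_on UNIV G" for G :: "'a \<Rightarrow> 'a"
    using compact_imp_bounded[OF compact_continuous_image[OF continuous_on_subset[OF that] compact_cball]]
    by (force simp: bounded_iff)
  from this[OF G\<^sub>0] this[OF G\<^sub>1] obtain M\<^sub>0 M\<^sub>1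
    where "\<forall>Z\<in>cball X 1. norm (G\<^sub>0 Z) \<le> M\<^sub>0" "\<forall>Z\<in>cball X 1. norm (G\<^sub>1 Z) \<le> M\<^sub>1" by blast
  then have M: "norm (G\<^sub>0 Z + h *\<^sub>R G\<^sub>1 Z) \<le> M\<^sub>0 + M\<^sub>1" if "Z \<in> cball X 1" "0 \<le> h" "h \<le> 1" for Z h
  proof -
    have "norm (h *\<^sub>R G\<^sub>1 Z) \<le> 1 * norm (G\<^sub>1 Z)" using that by (simp add: mult_left_le_one_le)
    then show ?thesis
      using \<open>\<forall>Z\<in>cball X 1. norm (G\<^sub>0 Z) \<le> M\<^sub>0\<close> \<open>\<forall>Z\<in>cball X 1. norm (G\<^sub>1 Z) \<le> M\<^sub>1\<close> that(1)
      by (intro norm_triangle_le add_mono) force+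
  qed
  have filter: "filterlim sqrt (at_right 0) (at_right 0)" by real_asymp
  have sqrt_small: "\<forall>\<^sub>F s in at_right 0. 0 < sqrt s \<and> sqrt s < d" if "d > 0" for d
    using eventually_compose_filterlim[OF eventually_at_right_real[OF that] filter] by simp
  show "\<forall>\<^sub>F s in at_right 0. \<exists>Y. ode_solution (?f s) X (sqrt s) Y"
  proof -
    have "M\<^sub>0 + M\<^sub>1 \<ge> 0" using order_trans[OF norm_ge_zero M[of X 0]] by simp
    \<comment> \<open>Below this threshold both \<open>(M\<^sub>0 + M\<^sub>1) * sqrt s < 1\<close>
      and \<open>sqrt s \<le> 1\<close> hold, as local existence and the bound \<open>M\<close>
      require.\<close>
    then have "1 / (M\<^sub>0 + M\<^sub>1 + 1) > 0" by simp
    then have "\<forall>\<^sub>F s in at_right 0. 0 < sqrt s \<and> sqrt s < 1 / (M\<^sub>0 + M\<^sub>1 + 1)" by (rule sqrt_small)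
    then show ?thesis
    proof eventually_elim
      case (elim s)
      then have "(M\<^sub>0 + M\<^sub>1) * sqrt s + sqrt s < 1" using \<open>M\<^sub>0 + M\<^sub>1 \<ge> 0\<close> by (simp add: field_simps)
      moreover have "(M\<^sub>0 + M\<^sub>1) * sqrt s \<ge> 0" using \<open>M\<^sub>0 + M\<^sub>1 \<ge> 0\<close> elim by simp
      ultimately have "(M\<^sub>0 + M\<^sub>1) * sqrt s < 1" "sqrt s \<le> 1" using elim by linarith+
      moreover have "continuous_on UNIV (?f s)" by (intro continuous_intros G\<^sub>0 G\<^sub>1)
      ultimately obtain Y where "ode_solution (?f s) X (sqrt s) Y"
        using elim by (elim peano_local[rotated 2]) (auto intro: M)
      then show ?case by blast
    qed
  qed
  fix Y
  assume Y: "\<forall>\<^sub>F s in at_right 0. ode_solution (?f s) X (sqrt s) (Y s)"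
  let ?E = "\<lambda>h. X + h *\<^sub>R G\<^sub>0 X + h\<^sup>2 *\<^sub>R (G\<^sub>1 X + (1 / 2) *\<^sub>R L X (G\<^sub>0 X))"
  have "(\<lambda>s. norm (Y s (sqrt s) - ?E (sqrt s))) \<in> o[at_right 0](\<lambda>s. (sqrt s)\<^sup>2)"
  proof (rule landau_o.smallI)
    fix \<epsilon> :: real assume "\<epsilon> > 0"
    have G\<^sub>1_at: "isCont G\<^sub>1 X" using G\<^sub>1 by (simp add: continuous_on_eq_continuous_at)
    obtain \<delta> where "\<delta> > 0" and \<delta>: "\<And>h Y. 0 < h \<Longrightarrow> h < \<delta> \<Longrightarrow>
        ode_solution (\<lambda>Z. G\<^sub>0 Z + h *\<^sub>R G\<^sub>1 Z) X h Y \<Longrightarrow> norm (Y h - ?E h) \<le> \<epsilon> * h\<^sup>2"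
      by (rule ode_solution_second_order[OF M L G\<^sub>1_at \<open>\<epsilon> > 0\<close>]) blast+
    show "\<forall>\<^sub>F s in at_right 0. norm (norm (Y s (sqrt s) - ?E (sqrt s))) \<le> \<epsilon> * norm ((sqrt s)\<^sup>2)"
      using Y sqrt_small[OF \<open>\<delta> > 0\<close>]
    proof eventually_elim
      case (elim s)
      then have "norm (Y s (sqrt s) - ?E (sqrt s)) \<le> \<epsilon> * (sqrt s)\<^sup>2" by (intro \<delta>) auto
      then show ?case by simp
    qed
  qed
  moreover have "(\<lambda>s. norm (\<Phi> X (sqrt s) - ?E (sqrt s))) \<in> o[at_right 0](\<lambda>s. (sqrt s)\<^sup>2)"
    by (rule landau_o.small.compose[OF expansion filter])
  ultimately have sum: "(\<lambda>s. norm (Y s (sqrt s) - ?E (sqrt s)) + norm (\<Phi> X (sqrt s) - ?E (sqrt s)))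
      \<in> o[at_right 0](\<lambda>s. (sqrt s)\<^sup>2)"
    by (rule sum_in_smallo)
  show "(\<lambda>s. norm (Y s (sqrt s) - \<Phi> X (sqrt s))) \<in> o[at_right 0](\<lambda>s. (sqrt s)\<^sup>2)"
  proof (rule landau_o.big_small_trans[OF _ sum], rule landau_o.bigI[of 1])
    show "\<forall>\<^sub>F s in at_right 0. norm (norm (Y s (sqrt s) - \<Phi> X (sqrt s))) \<le>
        1 * norm (norm (Y s (sqrt s) - ?E (sqrt s)) + norm (\<Phi> X (sqrt s) - ?E (sqrt s)))"
      by (intro always_eventually allI) (simp add: dist_triangle2 flip: dist_norm)
  qed simp
qed (rule \<Phi>0)

section \<open>The template of the accelerated gradient method\<close>

text \<open>The inverse of the change of variables in explicit form: the extrapolation is undone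
  first, then the scaled difference.\<close>

lemma nag_sc_state_eq_iff:
  assumes "s > 0"
  shows "nag_sc_state \<mu> s (p, q) = (y, v) \<longleftrightarrow>
    q = y - (beta_nag_sc \<mu> s * sqrt s) *\<^sub>R v \<and> p = q - sqrt s *\<^sub>R v"
proof -
  have "(1 / sqrt s) *\<^sub>R (q - p) = v \<longleftrightarrow> q - p = sqrt s *\<^sub>R v"
    using assms scaleR_cancel_left[of "sqrt s" "(1 / sqrt s) *\<^sub>R (q - p)" v] by simp
  then show ?thesis
    by (auto simp: nag_sc_state_def algebra_simps)
qed

lemma bij_nag_sc_state:
  assumes "s > 0"
  shows "bij (nag_sc_state \<mu> s)"
  unfolding bij_iff
proof
  fix X :: "'a \<times> 'a"
  obtain y v where X: "X = (y, v)" by (cases X)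
  show "\<exists>!P. nag_sc_state \<mu> s P = X"
    unfolding X by (rule ex1I[of _ "(y - (beta_nag_sc \<mu> s * sqrt s) *\<^sub>R v - sqrt s *\<^sub>R v,
        y - (beta_nag_sc \<mu> s * sqrt s) *\<^sub>R v)"]) (auto simp: nag_sc_state_eq_iff[OF assms])
qed

text \<open>Applying the inverse change of variables to a template step cancels all momentum terms
  and leaves a gradient step from the extrapolated point. The condition \<open>q' = q\<close> says
  that successive pairs overlap, so that an orbit comes from a single sequence.\<close>

lemma nag_sc_template_state_iff:
  assumes "s > 0"
  shows "nag_sc_state \<mu> s (q', r) = nag_sc_template F \<mu> (nag_sc_state \<mu> s (p, q)) (sqrt s) \<longleftrightarrow>
    q' = q \<and> r = q + beta_nag_sc \<mu> s *\<^sub>R (q - p) - s *\<^sub>R grad F (q + beta_nag_sc \<mu> s *\<^sub>R (q - p))"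
proof -
  define \<beta> where "\<beta> = beta_nag_sc \<mu> s"
  define v where "v = (1 / sqrt s) *\<^sub>R (q - p)"
  define y where "y = q + \<beta> *\<^sub>R (q - p)"
  have qp: "q - p = sqrt s *\<^sub>R v" using assms by (simp add: v_def)
  have y: "y = q + (\<beta> * sqrt s) *\<^sub>R v" by (simp add: y_def qp)
  have state: "nag_sc_state \<mu> s (p, q) = (y, v)"
    by (simp add: nag_sc_state_def y_def v_def \<beta>_def)
  have "nag_sc_template F \<mu> (y, v) (sqrt s) =
      (y + (sqrt s * \<beta>\<^sup>2) *\<^sub>R v - (s * (1 + \<beta>)) *\<^sub>R grad F y, \<beta> *\<^sub>R v - sqrt s *\<^sub>R grad F y)"
    using assms by (simp add: nag_sc_template_def \<beta>_def Let_def)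
  \<comment> \<open>The inverse applied to the template step: this gives the new iterate, the next
    identity its predecessor \<open>q\<close>. The gradient coefficients combine as
    \<open>- s * (1 + \<beta>) + s * \<beta> = - s\<close>.\<close>
  moreover have "y + (sqrt s * \<beta>\<^sup>2) *\<^sub>R v - (s * (1 + \<beta>)) *\<^sub>R grad F y
      - (\<beta> * sqrt s) *\<^sub>R (\<beta> *\<^sub>R v - sqrt s *\<^sub>R grad F y) = y - s *\<^sub>R grad F y"
    using assms by (simp add: algebra_simps power2_eq_square)
  moreover have "y - s *\<^sub>R grad F y - sqrt s *\<^sub>R (\<beta> *\<^sub>R v - sqrt s *\<^sub>R grad F y) = q"
    using assms by (simp add: y algebra_simps)
  ultimately show ?thesis
    unfolding state \<beta>_def[symmetric] y_def[symmetric]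
    by (auto simp: nag_sc_state_eq_iff[OF assms] simp flip: \<beta>_def)
qed

lemma nag_sc_equivalent_template:
  fixes F :: "'a::euclidean_space \<Rightarrow> real"
  assumes "s > 0"
  shows "equivalent_template_via (nag_sc_state \<mu> s) (nag_sc_sequences F \<mu> s)
    (\<lambda>X. nag_sc_template F \<mu> X (sqrt s))"
  unfolding equivalent_template_via_def
proof
  let ?\<Psi> = "nag_sc_state \<mu> s :: 'a \<times> 'a \<Rightarrow> _" and ?\<Phi> = "\<lambda>X. nag_sc_template F \<mu> X (sqrt s)"
  show bij: "bij ?\<Psi>" by (rule bij_nag_sc_state[OF assms])
  have inj: "P = Q" if "?\<Psi> P = ?\<Psi> Q" for P Q using bij that by (simp add: bij_is_inj inj_eq)
  have iff: "x \<in> nag_sc_sequences F \<mu> s \<longleftrightarrow>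
      (\<forall>k. ?\<Psi> (x (k + 1), x (k + 2)) = ?\<Phi> (?\<Psi> (x k, x (k + 1))))" for x :: "nat \<Rightarrow> 'a"
  proof -
    \<comment> \<open>The recurrence starts at index \<open>1\<close>, the orbits at
      \<open>0\<close>.\<close>
    have "(\<forall>k\<ge>1. P k) \<longleftrightarrow> (\<forall>k. P (k + 1))" for P :: "nat \<Rightarrow> bool"
      by (auto simp: Suc_le_eq gr0_conv_Suc)
    from this[of "\<lambda>k. x (k + 1) = x k + beta_nag_sc \<mu> s *\<^sub>R (x k - x (k - 1))
       - s *\<^sub>R grad F (x k + beta_nag_sc \<mu> s *\<^sub>R (x k - x (k - 1)))"]
    show ?thesis by (simp add: nag_sc_sequences_def nag_sc_template_state_iff[OF assms])
  qed
  show "bij_betw (\<lambda>x k. ?\<Psi> (x k, x (k + 1))) (nag_sc_sequences F \<mu> s) {X. \<forall>k. X (k + 1) = ?\<Phi> (X k)}"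
    unfolding bij_betw_def
  proof
    show "inj_on (\<lambda>x k. ?\<Psi> (x k, x (k + 1))) (nag_sc_sequences F \<mu> s)"
    proof (rule inj_onI, rule ext)
      fix x y k assume "(\<lambda>k. ?\<Psi> (x k, x (k + 1))) = (\<lambda>k. ?\<Psi> (y k, y (k + 1)))"
      then show "x k = y k" using inj by (metis Pair_inject)
    qed
    show "(\<lambda>x k. ?\<Psi> (x k, x (k + 1))) ` nag_sc_sequences F \<mu> s = {X. \<forall>k. X (k + 1) = ?\<Phi> (X k)}"
    proof
      show "(\<lambda>x k. ?\<Psi> (x k, x (k + 1))) ` nag_sc_sequences F \<mu> s \<subseteq> {X. \<forall>k. X (k + 1) = ?\<Phi> (X k)}"
        by (auto simp: iff)
      show "{X. \<forall>k. X (k + 1) = ?\<Phi> (X k)} \<subseteq> (\<lambda>x k. ?\<Psi> (x k, x (k + 1))) ` nag_sc_sequences F \<mu> s"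
      proof
        fix X :: "nat \<Rightarrow> 'a \<times> 'a" assume "X \<in> {X. \<forall>k. X (k + 1) = ?\<Phi> (X k)}"
        then have X: "X (k + 1) = ?\<Phi> (X k)" for k by simp
        have "\<forall>k. \<exists>p q. ?\<Psi> (p, q) = X k" using bij by (metis bij_pointE surj_pair)
        then obtain p q where pq: "\<And>k. ?\<Psi> (p k, q k) = X k" by metis
        \<comment> \<open>The overlap of consecutive pairs glues the preimages of the states into
          one sequence \<open>p\<close>.\<close>
        have "p (k + 1) = q k" for k :: nat
          using X[of k] by (simp add: nag_sc_template_state_iff[OF assms] flip: pq)
        then have "X = (\<lambda>k. ?\<Psi> (p k, p (k + 1)))" using pq by simp
        moreover from this have "p \<in> nag_sc_sequences F \<mu> s" using X by (simp add: iff)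
        ultimately show "X \<in> (\<lambda>x k. ?\<Psi> (x k, x (k + 1))) ` nag_sc_sequences F \<mu> s" by blast
      qed
    qed
  qed
qed

section \<open>Regularity of the vector field and expansion of the template\<close>

lemma grad_has_derivative:
  assumes "C2 F"
  shows "(grad F has_derivative (*v) (hessian F x)) (at x)"
  using assms unfolding C2_def hessian_def by (metis jacobian_works)

lemma continuous_on_matrix_vector_mult:
  fixes A :: "'a::topological_space \<Rightarrow> real^'n^'m"
  assumes "continuous_on S A" "continuous_on S v"
  shows "continuous_on S (\<lambda>z. A z *v v z)"
  unfolding matrix_vector_mult_def by (intro continuous_intros assms)

lemma beta_nag_sc_square:
  assumes "h > 0" "\<mu> > 0"
  shows "beta_nag_sc \<mu> (h\<^sup>2) = (1 - sqrt \<mu> * h) / (1 + sqrt \<mu> * h)"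
  using assms by (simp add: beta_nag_sc_def real_sqrt_mult)

text \<open>With \<open>m = sqrt \<mu>\<close>, the scalar expansions are
  \<open>h * \<beta>\<^sup>2 = h - 4 * m * h\<^sup>2 + O(h\<^sup>3)\<close>,
  \<open>h\<^sup>2 * (1 + \<beta>) = 2 * h\<^sup>2 + O(h\<^sup>3)\<close> and that of
  \<open>\<beta>\<close> itself. The gradient is evaluated only at the fixed point \<open>x\<close>,
  so the errors are scalar multiples of fixed vectors.\<close>

lemma nag_sc_template_expansion:
  fixes F :: "'a::euclidean_space \<Rightarrow> real"
  assumes "\<mu> > 0"
  shows "(\<lambda>h. norm (nag_sc_template F \<mu> (x, v) h -
      (x + h *\<^sub>R v - h\<^sup>2 *\<^sub>R ((4 * sqrt \<mu>) *\<^sub>R v + 2 *\<^sub>R grad F x),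
       v - h *\<^sub>R ((2 * sqrt \<mu>) *\<^sub>R v + grad F x) + h\<^sup>2 *\<^sub>R ((2 * \<mu>) *\<^sub>R v))))
    \<in> o[at_right 0](\<lambda>h. h\<^sup>2)"
proof -
  define m where "m = sqrt \<mu>"
  have "m > 0" and \<mu>: "\<mu> = m\<^sup>2" using assms by (auto simp: m_def)
  define \<beta> where "\<beta> h = (1 - m * h) / (1 + m * h)" for h
  \<comment> \<open>\<open>a\<close> and \<open>b\<close> are the errors in the coefficients of
    \<open>v\<close> and \<open>grad F x\<close> in the position component, \<open>c\<close> the
    error in that of \<open>v\<close> in the velocity component.\<close>
  define a where "a h = h * (\<beta> h)\<^sup>2 - h + 4 * m * h\<^sup>2" for h
  define b where "b h = h\<^sup>2 * (1 + \<beta> h) - 2 * h\<^sup>2" for h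
  define c where "c h = \<beta> h - 1 + 2 * m * h - 2 * m\<^sup>2 * h\<^sup>2" for h
  have ab: "a \<in> o[at_right 0](\<lambda>h. h\<^sup>2)" "b \<in> o[at_right 0](\<lambda>h. h\<^sup>2)"
    unfolding a_def[abs_def] b_def[abs_def] \<beta>_def using \<open>m > 0\<close> by real_asymp+
  \<comment> \<open>The exact value of \<open>c\<close> for \<open>h > 0\<close>, obtained by
    putting everything over the denominator \<open>1 + m * h\<close>.\<close>
  have "(\<lambda>h. - 2 * m ^ 3 * h ^ 3 / (1 + m * h)) \<in> o[at_right 0](\<lambda>h. h\<^sup>2)"
    using \<open>m > 0\<close> by real_asymp
  moreover have "\<forall>\<^sub>F h in at_right 0. c h = - 2 * m ^ 3 * h ^ 3 / (1 + m * h)"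
    using eventually_at_right_less[of 0]
  proof eventually_elim
    case (elim h)
    then have "1 + m * h > 0" using \<open>m > 0\<close> by (simp add: add_pos_pos)
    then show ?case
      by (simp add: c_def \<beta>_def field_simps power2_eq_square power3_eq_cube)
  qed
  ultimately have c: "c \<in> o[at_right 0](\<lambda>h. h\<^sup>2)"
    by (subst landau_o.small.in_cong)
  have mult_const: "(\<lambda>h. f h * k) \<in> o[at_right 0](\<lambda>h. h\<^sup>2)" if "f \<in> o[at_right 0](\<lambda>h. h\<^sup>2)"
    for f :: "real \<Rightarrow> real" and k :: real
    using that by (cases "k = 0") simp_all
  have small: "(\<lambda>h. (\<bar>a h\<bar> + \<bar>c h\<bar>) * norm v + \<bar>b h\<bar> * norm (grad F x)) \<in> o[at_right 0](\<lambda>h. h\<^sup>2)"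
    using ab c by (intro sum_in_smallo mult_const) simp_all
  have bound: "\<forall>\<^sub>F h in at_right 0. norm (norm (nag_sc_template F \<mu> (x, v) h -
      (x + h *\<^sub>R v - h\<^sup>2 *\<^sub>R ((4 * sqrt \<mu>) *\<^sub>R v + 2 *\<^sub>R grad F x),
       v - h *\<^sub>R ((2 * sqrt \<mu>) *\<^sub>R v + grad F x) + h\<^sup>2 *\<^sub>R ((2 * \<mu>) *\<^sub>R v))))
     \<le> 1 * norm ((\<bar>a h\<bar> + \<bar>c h\<bar>) * norm v + \<bar>b h\<bar> * norm (grad F x))"
    using eventually_at_right_less[of 0]
  proof eventually_elim
    case (elim h)
    have \<beta>: "beta_nag_sc \<mu> (h\<^sup>2) = \<beta> h"
      using beta_nag_sc_square[OF elim assms] by (simp add: \<beta>_def m_def)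
    have "nag_sc_template F \<mu> (x, v) h -
      (x + h *\<^sub>R v - h\<^sup>2 *\<^sub>R ((4 * sqrt \<mu>) *\<^sub>R v + 2 *\<^sub>R grad F x),
       v - h *\<^sub>R ((2 * sqrt \<mu>) *\<^sub>R v + grad F x) + h\<^sup>2 *\<^sub>R ((2 * \<mu>) *\<^sub>R v)) =
      (a h *\<^sub>R v - b h *\<^sub>R grad F x, c h *\<^sub>R v)"
      unfolding nag_sc_template_def Let_def \<beta> prod.case m_def[symmetric]
      by (simp add: \<mu> a_def b_def c_def algebra_simps) (simp only: mult_2 scaleR_left_distrib)
    also have "norm \<dots> \<le> norm (a h *\<^sub>R v - b h *\<^sub>R grad F x) + norm (c h *\<^sub>R v)"
      by (rule norm_Pair_le)
    also have "\<dots> \<le> (norm (a h *\<^sub>R v) + norm (b h *\<^sub>R grad F x)) + norm (c h *\<^sub>R v)"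
      by (intro add_right_mono norm_triangle_ineq4)
    finally show ?case by (simp add: algebra_simps)
  qed
  show ?thesis
    by (rule landau_o.big_small_trans[OF landau_o.bigI[OF zero_less_one bound] small])
qed

theorem corollary3p3:
  fixes F :: "real^'n \<Rightarrow> real" and \<mu> :: real
  assumes "\<mu> > 0" and "C2 F" and "strongly_convex \<mu> F"
  shows "(\<forall>s>0. equivalent_template_via (nag_sc_state \<mu> s)
            (nag_sc_sequences F \<mu> s) (\<lambda>X. nag_sc_template F \<mu> X (sqrt s))) \<and>
         sqrt_resolution_ode (nag_sc_template F \<mu>)
           (\<lambda>(x, v). (v, - (2 * sqrt \<mu>) *\<^sub>R v - grad F x))
           (\<lambda>(x, v). (1 / 2) *\<^sub>R
              (- (6 * sqrt \<mu>) *\<^sub>R v - 3 *\<^sub>R grad F x,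
               hessian F x *v v - (2 * sqrt \<mu>) *\<^sub>R grad F x))"
    (is "_ \<and> sqrt_resolution_ode _ ?G\<^sub>0 ?G\<^sub>1")
proof
  show "\<forall>s>0. equivalent_template_via (nag_sc_state \<mu> s)
      (nag_sc_sequences F \<mu> s) (\<lambda>X. nag_sc_template F \<mu> X (sqrt s))"
    using nag_sc_equivalent_template by blast
  \<comment> \<open>The derivative of the leading field at \<open>X\<close> in direction
    \<open>z\<close>.\<close>
  define L where "L = (\<lambda>(X :: (real^'n) \<times> (real^'n)) (z :: (real^'n) \<times> (real^'n)). (snd z, - (2 * sqrt \<mu>) *\<^sub>R snd z - hessian F (fst X) *v fst z))"
  show "sqrt_resolution_ode (nag_sc_template F \<mu>) ?G\<^sub>0 ?G\<^sub>1"
  proof (rule sqrt_resolution_odeI[where L=L])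
    show "nag_sc_template F \<mu> X 0 = X" for X
      by (cases X) (simp add: nag_sc_template_def beta_nag_sc_def)
    show "(?G\<^sub>0 has_derivative L X) (at X)" for X
    proof -
      have "((\<lambda>X. grad F (fst X)) has_derivative (\<lambda>z. hessian F (fst X) *v fst z)) (at X)"
        by (rule has_derivative_compose[OF has_derivative_fst[OF has_derivative_ident]
              grad_has_derivative[OF \<open>C2 F\<close>]])
      then have "((\<lambda>X. (snd X, - (2 * sqrt \<mu>) *\<^sub>R snd X - grad F (fst X))) has_derivative L X) (at X)"
        unfolding L_def by (intro derivative_intros)
      then show ?thesis by (simp add: case_prod_unfold)
    qed
    have grad: "continuous_on UNIV (grad F)"
      using has_derivative_continuous[OF grad_has_derivative[OF \<open>C2 F\<close>]]
      by (simp add: continuous_on_eq_continuous_at)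
    have hess: "continuous_on UNIV (hessian F)" using \<open>C2 F\<close> by (simp add: C2_def)
    have "continuous_on UNIV (\<lambda>X. grad F (fst X :: real^'n))"
      by (rule continuous_on_compose2[OF grad]) (auto intro: continuous_intros)
    moreover have "continuous_on UNIV (\<lambda>X. hessian F (fst X) *v snd X)"
      by (intro continuous_on_matrix_vector_mult continuous_on_compose2[OF hess] continuous_intros) auto
    ultimately show "continuous_on UNIV ?G\<^sub>1"
      unfolding case_prod_unfold by (intro continuous_intros)
    fix X :: "(real^'n) \<times> (real^'n)"
    obtain x v where X: "X = (x, v)" by (cases X)
    \<comment> \<open>Here \<open>w\<close> stands for \<open>hessian F x *v v\<close>. Its
      contributions from the correction field and from \<open>L\<close> along the leading field
      cancel, matching a template without second derivatives; \<open>2 * \<mu>\<close> arises from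
      \<open>(sqrt \<mu>)\<^sup>2 = \<mu>\<close>.\<close>
    have identities:
      "(1 / 2) *\<^sub>R (- (6 * sqrt \<mu>) *\<^sub>R v - 3 *\<^sub>R g) + (1 / 2) *\<^sub>R (- (2 * sqrt \<mu>) *\<^sub>R v - g) =
        - ((4 * sqrt \<mu>) *\<^sub>R v + 2 *\<^sub>R g)"
      "(1 / 2) *\<^sub>R (w - (2 * sqrt \<mu>) *\<^sub>R g) +
        (1 / 2) *\<^sub>R (- (2 * sqrt \<mu>) *\<^sub>R (- (2 * sqrt \<mu>) *\<^sub>R v - g) - w) = (2 * \<mu>) *\<^sub>R v"
      for g w :: "real^'n"
      using \<open>\<mu> > 0\<close> by (simp_all add: vec_eq_iff algebra_simps)
    have "X + h *\<^sub>R ?G\<^sub>0 X + h\<^sup>2 *\<^sub>R (?G\<^sub>1 X + (1 / 2) *\<^sub>R L X (?G\<^sub>0 X)) =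
      (x + h *\<^sub>R v - h\<^sup>2 *\<^sub>R ((4 * sqrt \<mu>) *\<^sub>R v + 2 *\<^sub>R grad F x),
       v - h *\<^sub>R ((2 * sqrt \<mu>) *\<^sub>R v + grad F x) + h\<^sup>2 *\<^sub>R ((2 * \<mu>) *\<^sub>R v))" for h
    proof -
      have "?G\<^sub>1 X + (1 / 2) *\<^sub>R L X (?G\<^sub>0 X) =
          (- ((4 * sqrt \<mu>) *\<^sub>R v + 2 *\<^sub>R grad F x), (2 * \<mu>) *\<^sub>R v)"
        by (simp only: X L_def prod.case fst_conv snd_conv scaleR_Pair add_Pair identities)
      then show ?thesis by (simp add: X algebra_simps)
    qed
    then show "(\<lambda>h. norm (nag_sc_template F \<mu> X h -
        (X + h *\<^sub>R ?G\<^sub>0 X + h\<^sup>2 *\<^sub>R (?G\<^sub>1 X + (1 / 2) *\<^sub>R L X (?G\<^sub>0 X))))) \<in> o[at_right 0](\<lambda>h. h\<^sup>2)"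
      using nag_sc_template_expansion[OF \<open>\<mu> > 0\<close>, of F x v] by (simp only: X)
  qed
qed

end
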